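(* Let $N\ge2$ be an integer, let $\tilde{\mathbf\Psi}=[\tilde\psi_0,\dots,\tilde\psi_N]^T$ be the vector of dual Bernstein polynomials of degree $N$, and let $\mathbf\Psi=[\psi_0,\dots,\psi_{N-2}]^T$ be the vector of modal basis functions. Then $$\mathbf\Psi'=\mathbf Q\,\tilde{\mathbf\Psi},$$ where $\mathbf Q=\mathbf G\mathbf P$ is an $(N-1)\times(N+1)$ matrix which is $(1,3)$-band, i.e. $q_{i,j}=0$ whenever $j<i-1$ or $j>i+3$ ($0\le i\le N-2$, $0\le j\le N$).
   Context: The Bernstein polynomials of degree $N$ on $[0,1]$ are $\phi_i(x)=\binom{N}{i}x^i(1-x)^{N-i}$, $0\le i\le N$. The dual Bernstein polynomials of degree $N$ are $\tilde\psi_i(x)=\sum_{j=0}^N c_{i,j}\phi_j(x)$, $0\le i\le N$, with $$c_{i,j}=\frac{(-1)^{i+j}}{\binom Ni\binom Nj}\sum_{r=0}^{\min(i,j)}(2r+1)\binom{N+r+1}{N-i}\binom{N-r}{N-i}\binom{N+r+1}{N-j}\binom{N-r}{N-j}.$$ They satisfy (known fact) $\int_0^1\phi_i\tilde\psi_j\,dx=\delta_{ij}$, which characterizes them among polynomials of degree at most $N$. The modal basis functions are $\psi_i=\tilde\psi_i+a_i\tilde\psi_{i+1}+b_i\tilde\psi_{i+2}$, $0\le i\le N-2$, with $a_i=\frac{2i+4}{N-i+1}$ and $b_i=\frac{(i+2)(i+3)}{(N-i)(N-i+1)}$. $\mathbf G=[g_{i,j}]$ is the $(N-1)\times(N+1)$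 matrix ($0\le i\le N-2$, $0\le j\le N$) with $g_{i,i}=1$, $g_{i,i+1}=a_i$, $g_{i,i+2}=b_i$ and all other entries $0$, so that $\mathbf\Psi=\mathbf G\tilde{\mathbf\Psi}$. $\mathbf P=[p_{i,j}]_{0\le i,j\le N}$ is the matrix with $p_{i,0}=-(-1)^i(N+1)\binom{N+1}{i+1}+N\delta_{i,0}+\delta_{i,1}$; $p_{i,N}=-p_{N-i,0}$; and, for $1\le j\le N-1$, $p_{i,j}=i$ if $j=i-1$, $p_{i,j}=N-2i$ if $j=i$, $p_{i,j}=-N+i$ if $j=i+1$, and $p_{i,j}=0$ otherwise. A $(p,q)$-band matrix is one whose nonzero entries all lie on the main diagonal, the first $p$ diagonals below it and the first $q$ diagonals above it. The prime denotes the entrywise derivative. *)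

theory Defs
  imports "HOL-Analysis.Weierstrass_Theorems" "Jordan_Normal_Form.Matrix"
begin

hide_const (open) Finite_Cartesian_Product.vec Finite_Cartesian_Product.row
  Finite_Cartesian_Product.column
no_notation Finite_Cartesian_Product.vec_nth (infixl \<open>$\<close> 90)

definition dual_coeff :: "nat \<Rightarrow> nat \<Rightarrow> nat \<Rightarrow> real" where
  "dual_coeff N i j =
     (-1) ^ (i + j) / (real (N choose i) * real (N choose j)) *
     (\<Sum>r = 0..min i j. real (2 * r + 1) *
        real ((N + r + 1) choose (N - i)) * real ((N - r) choose (N - i)) *
        real ((N + r + 1) choose (N - j)) * real ((N - r) choose (N - j)))"

definition dual_bernstein :: "nat \<Rightarrow> nat \<Rightarrow> real \<Rightarrow> real" where
  "dual_bernstein N i x = (\<Sum>j = 0..N. dual_coeff N i j * Bernstein N j x)"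

definition modal_a :: "nat \<Rightarrow> nat \<Rightarrow> real" where
  "modal_a N i = (2 * real i + 4) / (real N - real i + 1)"

definition modal_b :: "nat \<Rightarrow> nat \<Rightarrow> real" where
  "modal_b N i =
     ((real i + 2) * (real i + 3)) / ((real N - real i) * (real N - real i + 1))"

definition modal :: "nat \<Rightarrow> nat \<Rightarrow> real \<Rightarrow> real" where
  "modal N i x = dual_bernstein N i x + modal_a N i * dual_bernstein N (i + 1) x
     + modal_b N i * dual_bernstein N (i + 2) x"

definition dual_vec :: "nat \<Rightarrow> real \<Rightarrow> real vec" where
  "dual_vec N x = vec (N + 1) (\<lambda>i. dual_bernstein N i x)"

definition modal_vec :: "nat \<Rightarrow> real \<Rightarrow> real vec" where
  "modal_vec N x = vec (N - 1) (\<lambda>i. modal N i x)"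

definition G_mat :: "nat \<Rightarrow> real mat" where
  "G_mat N = mat (N - 1) (N + 1) (\<lambda>(i, j).
     if j = i then 1
     else if j = i + 1 then modal_a N i
     else if j = i + 2 then modal_b N i
     else 0)"

definition P_col0 :: "nat \<Rightarrow> nat \<Rightarrow> real" where
  "P_col0 N i = - ((-1) ^ i) * (real N + 1) * real ((N + 1) choose (i + 1))
     + real N * of_bool (i = 0) + of_bool (i = 1)"

definition P_mat :: "nat \<Rightarrow> real mat" where
  "P_mat N = mat (N + 1) (N + 1) (\<lambda>(i, j).
     if j = 0 then P_col0 N i
     else if j = N then - P_col0 N (N - i)
     else if i = j + 1 then real i
     else if i = j then real N - 2 * real i
     else if j = i + 1 then - real N + real i
     else 0)"

definition band_mat :: "nat \<Rightarrow> nat \<Rightarrow> 'a :: zero mat \<Rightarrow> bool" where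
  "band_mat p q A \<longleftrightarrow>
     (\<forall>i < dim_row A. \<forall>j < dim_col A. A $$ (i, j) \<noteq> 0 \<longrightarrow> i \<le> j + p \<and> j \<le> i + q)"

definition has_entrywise_derivative ::
    "(real \<Rightarrow> real vec) \<Rightarrow> (real \<Rightarrow> real vec) \<Rightarrow> bool" where
  "has_entrywise_derivative F F' \<longleftrightarrow>
     (\<forall>x. dim_vec (F x) = dim_vec (F' x)) \<and>
     (\<forall>x. \<forall>i < dim_vec (F' x). ((\<lambda>y. F y $ i) has_real_derivative F' x $ i) (at x))"

end

theory Submission
  imports Defs
begin

text \<open>
  Let D be the matrix of differentiation in the Bernstein basis and C the symmetric matrix of the
  coefficients of the dual basis. Expanding in the Bernstein basis, the derivatives of the dual
  polynomials are given by P precisely when \<open>P C = C D\<close>, which is a recurrence for the entries of C. With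
  \<open>u\<^sub>r(i) = binom(N+r+1, N-i) binom(i, r) / binom(N, r)\<close> the explicit formula reads
  \<open>c\<^sub>i\<^sub>k = (-1)^(i+k) \<Sum>\<^sub>r (2r+1) u\<^sub>r(i) u\<^sub>r(k)\<close>, and the recurrence follows from it because, after
  applying the recurrence operator termwise, the sum over r telescopes in the sense of Gosper.
  The full first and last columns of P do not spoil the band structure of \<open>G P\<close>, because the modal functions vanish at 0 and 1.
\<close>

section \<open>Factorised form of the dual coefficients\<close>

lemma binomial_shift_left:
  "(m choose Suc k) * Suc k = (m choose k) * (m - k)"
  by (metis binomial_absorb_comp binomial_absorption mult.commute)

definition dual_factor :: "nat \<Rightarrow> nat \<Rightarrow> nat \<Rightarrow> real" where
  "dual_factor N r i =
     real ((N + r + 1) choose (N - i)) * real (i choose r) / real (N choose r)"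

text \<open>Trinomial revision for \<open>r \<le> i\<close>; for \<open>r > i\<close> both
  numerators vanish. It absorbs the prefactors of the explicit formula into
  \<open>dual_factor\<close>.\<close>

lemma choose_ratio:
  assumes "r \<le> N" "i \<le> N"
  shows "real ((N - r) choose (N - i)) / real (N choose i) = real (i choose r) / real (N choose r)"
proof (cases "r \<le> i")
  case True
  have "(N choose i) * (i choose r) = (N choose r) * ((N - r) choose (i - r))"
    using choose_mult[OF True assms(2)] .
  moreover have "(N - r) choose (i - r) = (N - r) choose (N - i)"
    using True assms by (subst binomial_symmetric) auto
  ultimately have "real (N choose i) * real (i choose r) = real (N choose r) * real ((N - r) choose (N - i))"
    by (metis of_nat_mult)
  then show ?thesis using assms by (simp add: field_simps)
next
  case False
  then have "(N - r) choose (N - i) = 0" using assms by (intro binomial_eq_0) linarith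
  moreover have "i choose r = 0" using False by (intro binomial_eq_0) simp
  ultimately show ?thesis by (simp only: of_nat_0 div_0)
qed

text \<open>Terms beyond \<open>min i k\<close> vanish with \<open>i choose r\<close> or
  \<open>k choose r\<close>. The range of summation becomes independent of \<open>i\<close> and
  \<open>k\<close>, so operators in either index act termwise.\<close>

lemma dual_coeff_eq_sum:
  assumes "i \<le> N" "k \<le> N"
  shows "dual_coeff N i k =
     (-1) ^ (i + k) * (\<Sum>r\<le>N. (2 * real r + 1) * dual_factor N r i * dual_factor N r k)"
proof -
  have "(\<Sum>r\<le>N. (2 * real r + 1) * dual_factor N r i * dual_factor N r k)
      = (\<Sum>r = 0..min i k. (2 * real r + 1) * dual_factor N r i * dual_factor N r k)"
    using assms by (intro sum.mono_neutral_right) (auto simp: dual_factor_def)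
  also have "\<dots> = (\<Sum>r = 0..min i k. real (2 * r + 1) *
        real ((N + r + 1) choose (N - i)) * real ((N - r) choose (N - i)) *
        real ((N + r + 1) choose (N - k)) * real ((N - r) choose (N - k)))
        / (real (N choose i) * real (N choose k))"
    unfolding sum_divide_distrib
  proof (intro sum.cong refl)
    fix r assume "r \<in> {0..min i k}"
    then have r: "r \<le> N" using assms by auto
    have e: "dual_factor N r j = real ((N + r + 1) choose (N - j)) *
        (real ((N - r) choose (N - j)) / real (N choose j))" if "j \<le> N" for j
      unfolding dual_factor_def choose_ratio[OF r that] by simp
    show "(2 * real r + 1) * dual_factor N r i * dual_factor N r k = real (2 * r + 1) *
        real ((N + r + 1) choose (N - i)) * real ((N - r) choose (N - i)) *
        real ((N + r + 1) choose (N - k)) * real ((N - r) choose (N - k))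
        / (real (N choose i) * real (N choose k))"
      unfolding e[OF assms(1)] e[OF assms(2)] by simp
  qed
  finally show ?thesis by (simp add: dual_coeff_def)
qed

section \<open>Term ratios and telescoping of the recurrence\<close>

text \<open>
  This is \<open>(N+1-r) u\<^sub>r(i) / (i+1-r)\<close>, continued through \<open>r = i + 1\<close>, where \<open>u\<^sub>r(i)\<close> vanishes
  but \<open>u\<^sub>r(i+1)\<close> does not.
\<close>
definition tele_factor :: "nat \<Rightarrow> nat \<Rightarrow> nat \<Rightarrow> real" where
  "tele_factor N r i = real ((N + r + 1) choose (N - i)) * real (Suc i choose r)
     / real (Suc N choose r) * ((real N + 1) / (real i + 1))"

text \<open>Real subtraction makes this absorption identity, like the next one, valid without a
  bound on \<open>r\<close>: past the range both sides are 0.\<close>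

lemma choose_Suc_left:
  fixes n r :: nat
  shows "real (Suc n choose r) * (real n + 1 - real r) = (real n + 1) * real (n choose r)"
proof (cases "r \<le> Suc n")
  case True
  have "(Suc n - r) * (Suc n choose r) = Suc n * (n choose r)"
    using binomial_absorb_comp[of "Suc n" r] by simp
  then have "real (Suc n - r) * real (Suc n choose r) = real (Suc n) * real (n choose r)"
    by (metis of_nat_mult)
  then show ?thesis using True by (simp add: of_nat_diff mult.commute add.commute)
qed (simp add: binomial_eq_0)

lemma choose_Suc_right:
  fixes n r :: nat
  shows "real (n choose Suc r) * (real r + 1) = real (n choose r) * (real n - real r)"
proof (cases "r \<le> n")
  case True
  have "real (n choose Suc r) * real (Suc r) = real (n choose r) * real (n - r)"
    by (metis of_nat_mult binomial_shift_left)
  then show ?thesis using True by (simp add: of_nat_diff add.commute)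
qed (simp add: binomial_eq_0)

text \<open>Absorption in both \<open>i choose r\<close> and \<open>N choose r\<close>. The only
  denominator, \<open>N + 1 - r\<close>, stays positive; the inverse relation would break down at
  \<open>r = i + 1\<close>.\<close>

lemma dual_factor_eq_tele:
  assumes "r \<le> N"
  shows "dual_factor N r i = (real i + 1 - real r) / (real N + 1 - real r) * tele_factor N r i"
proof -
  have n: "real N + 1 - real r > 0" "real i + 1 > 0" "real N + 1 > 0" using assms by simp_all
  have e: "X * (Y * c / I) / (Z * p / M) = c / p * (X * Y / Z * (M / I))"
    if "p > 0" "I > 0" "M > 0" for c X Y Z p M I :: real
    using that by (simp add: field_simps)
  have a: "real (i choose r) = real (Suc i choose r) * (real i + 1 - real r) / (real i + 1)"
    using choose_Suc_left[of i r] by (simp add: field_simps)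
  have b: "real (N choose r) = real (Suc N choose r) * (real N + 1 - real r) / (real N + 1)"
    using choose_Suc_left[of N r] by (simp add: field_simps)
  show ?thesis unfolding dual_factor_def tele_factor_def a b by (rule e[OF n])
qed

text \<open>The ratio of neighbours in \<open>i\<close>. The factor \<open>real i\<close> on the
  left neutralises the truncated \<open>i - 1\<close> at \<open>i = 0\<close>.\<close>

lemma dual_factor_pred:
  assumes "r \<le> N" "i \<le> N"
  shows "real i * dual_factor N r (i - 1) =
    (real r + real i + 1) * (real i - real r) / (real N - real i + 1) * dual_factor N r i"
proof (cases i)
  case 0
  then show ?thesis by (cases r) (auto simp: dual_factor_def)
next
  case (Suc j)
  have d: "N - j = Suc (N - i)" using Suc assms by simp
  have a: "real ((N + r + 1) choose (N - j)) * (real N - real i + 1) =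
     real ((N + r + 1) choose (N - i)) * (real r + real i + 1)"
    using choose_Suc_right[of "N + r + 1" "N - i"] assms unfolding d by (simp add: of_nat_diff algebra_simps)
  have b: "real (i choose r) * (real i - real r) = real i * real (j choose r)"
    using choose_Suc_left[of j r] Suc by (simp add: algebra_simps)
  have n: "real N - real i + 1 > 0" using assms by simp
  have "real i * dual_factor N r j * (real N - real i + 1) =
     (real ((N + r + 1) choose (N - j)) * (real N - real i + 1)) * (real i * real (j choose r)) / real (N choose r)"
    by (simp add: dual_factor_def)
  also have "\<dots> = (real r + real i + 1) * (real i - real r) * dual_factor N r i"
    unfolding a b[symmetric] by (simp add: dual_factor_def)
  finally show ?thesis using n Suc by (simp add: field_simps)
qed

text \<open>The right side needs \<open>tele_factor\<close>: at \<open>r = i + 1\<close> with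
  \<open>i < N\<close>, \<open>dual_factor N r i\<close> is 0 but
  \<open>dual_factor N r (i + 1)\<close> is not. The factor \<open>N - i\<close> settles
  \<open>i = N\<close>.\<close>

lemma dual_factor_Suc:
  assumes "r \<le> N" "i \<le> N"
  shows "(real N - real i) * dual_factor N r (i + 1) =
    (real N - real i)^2 * (real i + 1) / ((real r + real i + 2) * (real N + 1 - real r)) * tele_factor N r i"
proof (cases "i = N")
  case False
  then have i: "i < N" using assms by simp
  have d: "N - i = Suc (N - Suc i)" using i by simp
  have a: "real ((N + r + 1) choose (N - Suc i)) =
     real ((N + r + 1) choose (N - i)) * (real N - real i) / (real r + real i + 2)"
    using choose_Suc_right[of "N + r + 1" "N - Suc i"] i unfolding d[symmetric]
    by (simp add: of_nat_diff field_simps)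
  have b: "real (N choose r) = real (Suc N choose r) * (real N + 1 - real r) / (real N + 1)"
    using choose_Suc_left[of N r] by (simp add: field_simps)
  have n: "real N + 1 - real r > 0" "real r + real i + 2 > 0" "real i + 1 > 0" "real N + 1 > 0"
    using assms by simp_all
  have e: "d * (X * d / q * Y / (Z * p / M)) = d^2 * I / (q * p) * (X * Y / Z * (M / I))"
    if "p > 0" "q > 0" "I > 0" "M > 0" for d X Y Z p q M I :: real
    using that by (simp add: field_simps power2_eq_square)
  show ?thesis
    unfolding dual_factor_def tele_factor_def b Suc_eq_plus1[symmetric] a[folded Suc_eq_plus1]
    by (rule e[OF n])
qed simp

lemma tele_factor_Suc:
  assumes "r \<le> N" "i \<le> N"
  shows "tele_factor N (Suc r) i =
    (real N + real r + 2) * (real i + 1 - real r) / ((real r + real i + 2) * (real N + 1 - real r)) * tele_factor N r i"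
proof -
  have n: "real N + 1 - real r > 0" "real r + real i + 2 > 0" "real i + 1 > 0" "real N + 1 > 0" "real r + 1 > 0"
    using assms by simp_all
  have a: "real ((N + Suc r + 1) choose (N - i)) =
     real ((N + r + 1) choose (N - i)) * (real N + real r + 2) / (real r + real i + 2)"
    using choose_Suc_left[of "N + r + 1" "N - i"] assms n
    by (simp add: of_nat_diff field_simps del: binomial_Suc_Suc)
  have b: "real (Suc m choose Suc r) = real (Suc m choose r) * (real m + 1 - real r) / (real r + 1)" for m
    using choose_Suc_right[of "Suc m" r] n by (simp add: field_simps del: binomial_Suc_Suc)
  have p: "real (Suc N choose r) > 0" using assms by (auto simp del: binomial_Suc_Suc)
  show ?thesis
    unfolding tele_factor_def a b using n p by (simp add: divide_simps del: binomial_Suc_Suc)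
qed

text \<open>
  The Gosper certificate. The bracket is the even polynomial in r of degree 4 whose values at 0,
  \<open>i + 1\<close> and \<open>k + 1\<close> are forced by the boundary term and by the poles of the summand.
\<close>
definition antidiff :: "nat \<Rightarrow> nat \<Rightarrow> nat \<Rightarrow> nat \<Rightarrow> real" where
  "antidiff N i k r = tele_factor N r i * tele_factor N r k *
     ((real r)^2 - (real i + 1) * (real k + 1)
      + ((real i + 1)^2 - (real r)^2) * ((real k + 1)^2 - (real r)^2)
        / ((real N - real i + 1) * (real N - real k + 1)))"

text \<open>The tridiagonal part of \<open>P_mat\<close>, acting on sequences. The values reached
  outside \<open>0..N\<close> get weight 0: \<open>i - 1\<close> at \<open>i = 0\<close> and
  \<open>i + 1\<close> at \<open>i = N\<close>.\<close>

definition shift_op :: "nat \<Rightarrow> (nat \<Rightarrow> real) \<Rightarrow> nat \<Rightarrow> real" where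
  "shift_op N f i = real i * f (i - 1) + (real N - 2 * real i) * f i - (real N - real i) * f (i + 1)"

text \<open>The identity of \<open>gosper_algebra\<close> with all denominators cleared.\<close>

lemma gosper_polynomial:
  fixes n r i k :: real
  shows "(2 * r + 1) *
        ((((n - 2 * i) * (i + 1 - r) * (n - i + 1) - (r + i + 1) * (i - r) * (i + 1 - r)) * (r + i + 2) +
          (n - i)\<^sup>2 * (i + 1) * (n - i + 1)) * ((k + 1 - r) * ((n - k + 1) * (r + k + 2))) +
         (i + 1 - r) * (((n - 2 * k) * (k + 1 - r) * (n - k + 1) -
           (r + k + 1) * (k - r) * (k + 1 - r)) * (r + k + 2) +
          (n - k)\<^sup>2 * (k + 1) * (n - k + 1)) * ((n - i + 1) * (r + i + 2))) =
        (n + r + 2) * (i + 1 - r) * ((n + r + 2) * (k + 1 - r)) *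
        (((r + 1)\<^sup>2 - (i + 1) * (k + 1)) * ((n - i + 1) * (n - k + 1)) +
         ((i + 1)\<^sup>2 - (r + 1)\<^sup>2) * ((k + 1)\<^sup>2 - (r + 1)\<^sup>2)) -
        ((r\<^sup>2 - (i + 1) * (k + 1)) * ((n - i + 1) * (n - k + 1)) +
         ((i + 1)\<^sup>2 - r\<^sup>2) * ((k + 1)\<^sup>2 - r\<^sup>2)) *
        ((r + i + 2) * (n + 1 - r) * ((r + k + 2) * (n + 1 - r)))"
  by Groebner_Basis.algebra \<comment> \<open>unqualified, the name denotes the method of HOL-Algebra\<close>

text \<open>The telescoping identity divided by
  \<open>tele_factor N r i * tele_factor N r k\<close>; \<open>ui\<close> and \<open>uk\<close> are
  the quotients of \<open>dual_factor\<close> by \<open>tele_factor\<close>.\<close>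

lemma gosper_algebra:
  fixes n r i k :: real
  assumes "n + 1 - r \<noteq> 0" "r + i + 2 \<noteq> 0" "r + k + 2 \<noteq> 0" "n - i + 1 \<noteq> 0" "n - k + 1 \<noteq> 0"
  defines "ui \<equiv> (i + 1 - r) / (n + 1 - r)" and "uk \<equiv> (k + 1 - r) / (n + 1 - r)"
  shows "(2 * r + 1) * ((- ((r + i + 1) * (i - r) / (n - i + 1) * ui) + (n - 2 * i) * ui
           + (n - i)^2 * (i + 1) / ((r + i + 2) * (n + 1 - r))) * uk
         + ui * (- ((r + k + 1) * (k - r) / (n - k + 1) * uk) + (n - 2 * k) * uk
           + (n - k)^2 * (k + 1) / ((r + k + 2) * (n + 1 - r))))
     = (n + r + 2) * (i + 1 - r) / ((r + i + 2) * (n + 1 - r)) *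
       ((n + r + 2) * (k + 1 - r) / ((r + k + 2) * (n + 1 - r))) *
       ((r + 1)^2 - (i + 1) * (k + 1)
         + ((i + 1)^2 - (r + 1)^2) * ((k + 1)^2 - (r + 1)^2) / ((n - i + 1) * (n - k + 1)))
     - (r^2 - (i + 1) * (k + 1)
         + ((i + 1)^2 - r^2) * ((k + 1)^2 - r^2) / ((n - i + 1) * (n - k + 1)))"
proof -
  show ?thesis unfolding ui_def uk_def using assms(1-5) gosper_polynomial[of r n i k] by (simp add: divide_simps)
qed

text \<open>Every term is a rational multiple of
  \<open>tele_factor N r i * tele_factor N r k\<close>, which leaves \<open>gosper_algebra\<close>.
  \<open>D\<close> is \<open>shift_op\<close> conjugated by the sign
  \<open>(-1) ^ j\<close>.\<close>

lemma antidiff_step: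
  assumes "r \<le> N" "i \<le> N" "k \<le> N"
  defines "D \<equiv> \<lambda>j. - (real j * dual_factor N r (j - 1)) + (real N - 2 * real j) * dual_factor N r j
     + (real N - real j) * dual_factor N r (j + 1)"
  shows "(2 * real r + 1) * (D i * dual_factor N r k + dual_factor N r i * D k)
     = antidiff N i k (Suc r) - antidiff N i k r"
proof -
  have D: "D j = (- ((real r + real j + 1) * (real j - real r) / (real N - real j + 1) * ((real j + 1 - real r) / (real N + 1 - real r)))
     + (real N - 2 * real j) * ((real j + 1 - real r) / (real N + 1 - real r))
     + (real N - real j)^2 * (real j + 1) / ((real r + real j + 2) * (real N + 1 - real r))) * tele_factor N r j"
    if "j \<le> N" for j
  proof -
    have e: "- (p * (u * t)) + q * (u * t) + v * t = (- (p * u) + q * u + v) * t" for p q t u v :: real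
      by (simp add: algebra_simps)
    show ?thesis
      unfolding D_def dual_factor_pred[OF assms(1) that] dual_factor_Suc[OF assms(1) that]
      unfolding dual_factor_eq_tele[OF assms(1)] e ..
  qed
  have eq: "(2 * real r + 1) * (d * t * (u' * t') + u * t * (d' * t')) = (2 * real r + 1) * (d * u' + u * d') * (t * t')"
    for d t u d' t' u' by (simp add: algebra_simps)
  have eq2: "q * t * (q' * t') * g' - t * t' * g = (q * q' * g' - g) * (t * t')" for q t q' t' g g' :: real
    by (simp add: algebra_simps)
  have nz: "real N + 1 - real r \<noteq> 0" "real r + real i + 2 \<noteq> 0" "real r + real k + 2 \<noteq> 0"
    "real N - real i + 1 \<noteq> 0" "real N - real k + 1 \<noteq> 0"
    using assms by linarith+
  show ?thesis
    unfolding D[OF assms(2)] D[OF assms(3)] dual_factor_eq_tele[OF assms(1)] eq gosper_algebra[OF nz]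
      antidiff_def tele_factor_Suc[OF assms(1,2)] tele_factor_Suc[OF assms(1,3)] eq2
    by (simp add: add.commute)
qed

section \<open>Boundary values of the telescoping sum\<close>

lemma tele_factor_end: "i < N \<Longrightarrow> tele_factor N (Suc N) i = 0"
  by (simp add: tele_factor_def binomial_eq_0 del: binomial_Suc_Suc)

lemma tele_factor_0:
  assumes "i \<le> N"
  shows "tele_factor N 0 i = real (Suc N choose Suc i) * (real N + 1) / (real i + 1)"
proof -
  have "Suc N choose (N - i) = Suc N choose Suc i"
    using assms by (subst binomial_symmetric) auto
  then show ?thesis by (simp add: tele_factor_def del: binomial_Suc_Suc)
qed

lemma antidiff_end:
  assumes "i \<le> N" "k \<le> N"
  shows "antidiff N i k (Suc N) = 0"
proof (cases "i = N \<and> k = N")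
  \<comment> \<open>Here the \<open>tele_factor\<close> values do not vanish, but the bracket does:
    \<open>(N+1)^2 - (N+1)^2\<close> plus a zero product.\<close>
  case True
  then show ?thesis by (simp add: antidiff_def power2_eq_square add.commute)
next
  case False
  then have "i < N \<or> k < N" using assms by auto
  then show ?thesis by (auto simp: antidiff_def tele_factor_end)
qed

lemma choose_Suc_eq:
  assumes "j \<le> N"
  shows "real (Suc N choose j) = real (Suc N choose Suc j) * (real j + 1) / (real N - real j + 1)"
  using choose_Suc_right[of "Suc N" j] assms by (simp add: field_simps del: binomial_Suc_Suc)

text \<open>At \<open>r = 0\<close> the quotient in the bracket turns the binomials over
  \<open>Suc i\<close>, \<open>Suc k\<close> into those over \<open>i\<close>, \<open>k\<close>. Up
  to sign, the two products are those of the first and last columns of the dual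
  coefficients.\<close>

lemma antidiff_0:
  assumes "i \<le> N" "k \<le> N"
  shows "antidiff N i k 0 = - ((real N + 1)^2 * (real (Suc N choose Suc i) * real (Suc N choose Suc k)
     - real (Suc N choose i) * real (Suc N choose k)))"
proof -
  have e: "X * M / I * (Y * M / K) * (0\<^sup>2 - I * K + (I\<^sup>2 - 0\<^sup>2) * (K\<^sup>2 - 0\<^sup>2) / (d * e)) =
     - (M\<^sup>2 * (X * Y - X * I / d * (Y * K / e)))"
    if "I > 0" "K > 0" "d > 0" "e > 0" for X Y M I K d e :: real
    using that by (simp add: field_simps power2_eq_square)
  show ?thesis
    unfolding antidiff_def tele_factor_0[OF assms(1)] tele_factor_0[OF assms(2)] choose_Suc_eq[OF assms(1)] choose_Suc_eq[OF assms(2)] of_nat_0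
    by (rule e) (use assms in auto)
qed

section \<open>First and last columns and recurrence of the dual coefficients\<close>

lemma dual_coeff_commute:
  assumes "i \<le> N" "k \<le> N"
  shows "dual_coeff N i k = dual_coeff N k i"
  using assms by (simp add: dual_coeff_eq_sum ac_simps)

lemma dual_coeff_0_right:
  assumes "i \<le> N"
  shows "dual_coeff N i 0 = (-1) ^ i * (real N + 1) * real (Suc N choose Suc i)"
proof -
  have "Suc N choose (N - i) = Suc N choose Suc i"
    using assms by (subst binomial_symmetric) auto
  moreover have "N choose (N - i) = N choose i"
    using assms by (metis binomial_symmetric)
  ultimately show ?thesis using assms by (simp add: dual_coeff_def del: binomial_Suc_Suc)
qed

lemma dual_coeff_N_right:
  assumes "i \<le> N"
  shows "dual_coeff N i N = (-1) ^ (i + N) * (real N + 1) * real (Suc N choose i)"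
proof -
  \<comment> \<open>Since \<open>dual_factor N r N = 1\<close>, a single factor remains and the sum
    is again Gosper-summable, with antidifference \<open>g\<close>.\<close>
  define g where "g r = - ((real i + 1 + real r) * (real i + 1 - real r) / (real N - real i + 1) * tele_factor N r i)" for r
  have "(2 * real r + 1) * dual_factor N r i * dual_factor N r N = g (Suc r) - g r" if "r \<le> N" for r
  proof -
    have nz: "real N + 1 - real r \<noteq> 0" "real r + real i + 2 \<noteq> 0" "real N - real i + 1 \<noteq> 0"
      using assms that by linarith+
    have "dual_factor N r N = 1" using that by (simp add: dual_factor_def)
    then show ?thesis
      unfolding g_def tele_factor_Suc[OF that assms] dual_factor_eq_tele[OF that, of i]
      using nz by (simp add: divide_simps) (simp add: algebra_simps)
  qed
  then have "(\<Sum>r\<le>N. (2 * real r + 1) * dual_factor N r i * dual_factor N r N) = (\<Sum>r<Suc N. g (Suc r) - g r)"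
    by (intro sum.cong) auto
  also have "\<dots> = g (Suc N) - g 0" by (rule sum_lessThan_telescope)
  also have "g (Suc N) = 0"
    using assms by (cases "i = N") (auto simp: g_def tele_factor_end)
  also have "0 - g 0 = (real N + 1) * real (Suc N choose i)"
    unfolding g_def tele_factor_0[OF assms] choose_Suc_eq[OF assms] by simp
  finally show ?thesis using assms by (simp add: dual_coeff_eq_sum del: binomial_Suc_Suc)
qed

text \<open>Agreement up to \<open>N\<close> suffices because \<open>f (N + 1)\<close> has weight 0
  at \<open>i = N\<close>; the sum formula for the coefficients is available only there.\<close>

lemma shift_op_cong:
  assumes "\<And>j. j \<le> N \<Longrightarrow> f j = g j" "i \<le> N"
  shows "shift_op N f i = shift_op N g i"
  using assms by (cases "i = N") (auto simp: shift_op_def)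

lemma shift_op_sum: "shift_op N (\<lambda>j. \<Sum>r\<in>A. f r j) i = (\<Sum>r\<in>A. shift_op N (f r) i)"
  by (simp add: shift_op_def sum.distrib sum_subtractf sum_distrib_left)

lemma shift_op_mult_right: "shift_op N (\<lambda>j. f j * c) i = shift_op N f i * c"
  by (simp add: shift_op_def algebra_simps)

lemma shift_op_mult_left: "shift_op N (\<lambda>j. c * f j) i = c * shift_op N f i"
  by (simp add: shift_op_def algebra_simps)

lemma shift_op_alternating:
  "shift_op N (\<lambda>j. (-1) ^ j * f j) i = (-1) ^ i *
     (- (real i * f (i - 1)) + (real N - 2 * real i) * f i + (real N - real i) * f (i + 1))"
  by (cases i) (auto simp: shift_op_def algebra_simps)

text \<open>The entrywise form of \<open>P C = C D\<close>: the operator on the row index is the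
  tridiagonal part of \<open>P\<close>, the one on the column index is \<open>- C D\<close>, and the
  right side comes from the two full columns of \<open>P\<close>.\<close>

lemma dual_coeff_recurrence:
  assumes "i \<le> N" "k \<le> N"
  shows "shift_op N (\<lambda>j. dual_coeff N j k) i + shift_op N (\<lambda>j. dual_coeff N i j) k
     = dual_coeff N i 0 * dual_coeff N 0 k - dual_coeff N i N * dual_coeff N N k"
proof -
  define w where "w r j = (-1) ^ j * dual_factor N r j" for r j
  define D where "D r j = - (real j * dual_factor N r (j - 1)) + (real N - 2 * real j) * dual_factor N r j
     + (real N - real j) * dual_factor N r (j + 1)" for r j
  \<comment> \<open>Each term separates into a function of \<open>j\<close> and one of
    \<open>l\<close>, so the operator hits one factor only.\<close>
  have c: "dual_coeff N j l = (\<Sum>r\<le>N. (2 * real r + 1) * w r j * w r l)" if "j \<le> N" "l \<le> N" for j l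
    unfolding dual_coeff_eq_sum[OF that] w_def sum_distrib_left by (simp add: power_add ac_simps)
  have w: "shift_op N (w r) j = (-1) ^ j * D r j" for r j
    unfolding w_def D_def by (rule shift_op_alternating)
  have 1: "shift_op N (\<lambda>j. dual_coeff N j k) i = (\<Sum>r\<le>N. (2 * real r + 1) * shift_op N (w r) i * w r k)"
    by (subst shift_op_cong[OF c[OF _ assms(2)] assms(1)])
      (simp_all add: shift_op_sum shift_op_mult_right shift_op_mult_left)
  have 2: "shift_op N (\<lambda>j. dual_coeff N i j) k = (\<Sum>r\<le>N. (2 * real r + 1) * w r i * shift_op N (w r) k)"
    by (subst shift_op_cong[OF c[OF assms(1)] assms(2)])
      (simp_all add: shift_op_sum shift_op_mult_right shift_op_mult_left)
  have "shift_op N (\<lambda>j. dual_coeff N j k) i + shift_op N (\<lambda>j. dual_coeff N i j) k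
     = (\<Sum>r\<le>N. (-1) ^ (i + k) * ((2 * real r + 1) * (D r i * dual_factor N r k + dual_factor N r i * D r k)))"
    unfolding 1 2 sum.distrib[symmetric] w by (intro sum.cong) (simp_all add: w_def power_add algebra_simps)
  also have "\<dots> = (-1) ^ (i + k) * (\<Sum>r<Suc N. antidiff N i k (Suc r) - antidiff N i k r)"
    unfolding sum_distrib_left lessThan_Suc_atMost
  proof (intro sum.cong refl)
    fix r assume "r \<in> {..N}"
    then have r: "r \<le> N" by simp
    show "(-1) ^ (i + k) * ((2 * real r + 1) * (D r i * dual_factor N r k + dual_factor N r i * D r k))
      = (-1) ^ (i + k) * (antidiff N i k (Suc r) - antidiff N i k r)"
      using antidiff_step[OF r assms] unfolding D_def by (rule arg_cong)
  qed
  also have "\<dots> = (-1) ^ (i + k) * ((real N + 1)^2 * (real (Suc N choose Suc i) * real (Suc N choose Suc k)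
     - real (Suc N choose i) * real (Suc N choose k)))"
    unfolding sum_lessThan_telescope antidiff_end[OF assms] antidiff_0[OF assms] by simp
  also have "\<dots> = dual_coeff N i 0 * dual_coeff N k 0 - dual_coeff N i N * dual_coeff N k N"
    unfolding dual_coeff_0_right[OF assms(1)] dual_coeff_0_right[OF assms(2)]
      dual_coeff_N_right[OF assms(1)] dual_coeff_N_right[OF assms(2)]
    by (simp add: power_add power2_eq_square algebra_simps del: binomial_Suc_Suc flip: power_mult_distrib)
  finally show ?thesis
    using dual_coeff_commute[OF assms(2), of 0] dual_coeff_commute[OF assms(2), of N] by simp
qed

section \<open>Differentiation in the Bernstein basis\<close>

text \<open>For \<open>m < N\<close> this is N times the m-th Bernstein polynomial of degree \<open>N - 1\<close>.\<close>
definition elevated_Bernstein :: "nat \<Rightarrow> nat \<Rightarrow> real \<Rightarrow> real" where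
  "elevated_Bernstein N m x = (real N - real m) * real (N choose m) * x ^ m * (1 - x) ^ (N - Suc m)"

text \<open>Degree elevation: multiply by \<open>1 = (1 - x) + x\<close>. For
  \<open>m \<ge> N\<close> everything vanishes.\<close>

lemma elevated_Bernstein_eq:
  "elevated_Bernstein N m x = (real N - real m) * Bernstein N m x + (real m + 1) * Bernstein N (Suc m) x"
proof (cases "m < N")
  case True
  then have "N - m = Suc (N - Suc m)" by simp
  moreover have "(real m + 1) * real (N choose Suc m) = (real N - real m) * real (N choose m)"
    using choose_Suc_right[of N m] by (simp add: mult.commute)
  ultimately have "(real N - real m) * Bernstein N m x + (real m + 1) * Bernstein N (Suc m) x
    = (real N - real m) * real (N choose m) * (x ^ m * ((1 - x) * (1 - x) ^ (N - Suc m)))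
      + ((real N - real m) * real (N choose m)) * (x ^ Suc m * (1 - x) ^ (N - Suc m))"
    by (simp add: Bernstein_def mult.assoc flip: mult.assoc[of "real m + 1"])
  also have "\<dots> = elevated_Bernstein N m x"
    by (simp add: elevated_Bernstein_def algebra_simps)
  finally show ?thesis by simp
next
  case False
  then show ?thesis by (cases "m = N") (auto simp: elevated_Bernstein_def Bernstein_def binomial_eq_0)
qed

lemma Bernstein_has_real_derivative:
  assumes "j \<le> N"
  shows "(Bernstein N j has_real_derivative (if j = 0 then 0 else elevated_Bernstein N (j - 1) x) - elevated_Bernstein N j x) (at x)"
proof -
  have "((\<lambda>x. real (N choose j) * x ^ j * (1 - x) ^ (N - j)) has_real_derivative
     real (N choose j) * real j * x ^ (j - 1) * (1 - x) ^ (N - j)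
     - (real N - real j) * real (N choose j) * x ^ j * (1 - x) ^ (N - Suc j)) (at x)"
    using assms by (auto intro!: derivative_eq_intros simp: of_nat_diff algebra_simps)
  moreover have "real (N choose j) * real j * x ^ (j - 1) * (1 - x) ^ (N - j)
     = (if j = 0 then 0 else elevated_Bernstein N (j - 1) x)"
  proof (cases j)
    case (Suc m)
    then have "real (N choose j) * real j = (real N - real m) * real (N choose m)"
      using choose_Suc_right[of N m] by (simp add: algebra_simps)
    then show ?thesis using Suc by (simp add: elevated_Bernstein_def)
  qed simp
  ultimately show ?thesis by (simp add: elevated_Bernstein_def Bernstein_def[abs_def])
qed

text \<open>Abel summation. The boundary term disappears in the application, where
  \<open>M = N\<close> and \<open>elevated_Bernstein N N x = 0\<close>.\<close>

lemma sum_by_parts: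
  fixes c B :: "nat \<Rightarrow> real"
  shows "(\<Sum>j\<le>M. c j * ((if j = 0 then 0 else B (j - 1)) - B j))
    = (\<Sum>j<M. (c (Suc j) - c j) * B j) - c M * B M"
  by (induction M) (simp_all add: algebra_simps)

text \<open>Collects coefficients after degree elevation. Keeping \<open>n\<close> apart from
  \<open>M\<close> permits the induction; the correction term vanishes for
  \<open>n = M\<close>.\<close>

lemma sum_regroup:
  fixes d p :: "nat \<Rightarrow> real"
  shows "(\<Sum>j<M. d j * ((n - real j) * p j + (real j + 1) * p (Suc j)))
    = (\<Sum>k\<le>M. ((n - real k) * d k + real k * d (k - 1)) * p k) - (n - real M) * d M * p M"
  by (induction M) (simp_all add: algebra_simps)

text \<open>Differentiation acts on Bernstein coefficients as \<open>- shift_op\<close>, by Abel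
  summation followed by degree elevation.\<close>

lemma sum_Bernstein_has_real_derivative:
  "((\<lambda>x. \<Sum>j = 0..N. c j * Bernstein N j x) has_real_derivative
     (\<Sum>k = 0..N. - shift_op N c k * Bernstein N k x)) (at x)"
proof -
  define d where "d j = c (Suc j) - c j" for j
  have "((\<lambda>x. \<Sum>j = 0..N. c j * Bernstein N j x) has_real_derivative
     (\<Sum>j = 0..N. c j * ((if j = 0 then 0 else elevated_Bernstein N (j - 1) x) - elevated_Bernstein N j x))) (at x)"
    by (intro DERIV_sum DERIV_cmult Bernstein_has_real_derivative) auto
  also have "(\<Sum>j = 0..N. c j * ((if j = 0 then 0 else elevated_Bernstein N (j - 1) x) - elevated_Bernstein N j x))
     = (\<Sum>j<N. d j * elevated_Bernstein N j x)"
    unfolding atLeast0AtMost sum_by_parts[of c "\<lambda>j. elevated_Bernstein N j x"] by (simp add: elevated_Bernstein_def d_def)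
  also have "\<dots> = (\<Sum>k\<le>N. ((real N - real k) * d k + real k * d (k - 1)) * Bernstein N k x)"
    unfolding elevated_Bernstein_eq
    using sum_regroup[where d = d and n = "real N" and p = "\<lambda>j. Bernstein N j x" and M = N] by simp
  also have "\<dots> = (\<Sum>k = 0..N. - shift_op N c k * Bernstein N k x)"
    unfolding atLeast0AtMost
  proof (intro sum.cong refl)
    fix k
    show "((real N - real k) * d k + real k * d (k - 1)) * Bernstein N k x = - shift_op N c k * Bernstein N k x"
      by (cases k) (simp_all add: d_def shift_op_def algebra_simps)
  qed
  finally show ?thesis .
qed

text \<open>The recurrence moves the operator from the Bernstein index \<open>k\<close> to the dual
  index \<open>i\<close>.\<close>

lemma dual_bernstein_has_real_derivative:
  assumes "i \<le> N"
  shows "(dual_bernstein N i has_real_derivative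
     shift_op N (\<lambda>j. dual_bernstein N j x) i - dual_coeff N i 0 * dual_bernstein N 0 x
     + dual_coeff N i N * dual_bernstein N N x) (at x)"
proof -
  have "(\<Sum>k = 0..N. - shift_op N (dual_coeff N i) k * Bernstein N k x)
    = (\<Sum>k = 0..N. shift_op N (\<lambda>j. dual_coeff N j k * Bernstein N k x) i
        - dual_coeff N i 0 * (dual_coeff N 0 k * Bernstein N k x)
        + dual_coeff N i N * (dual_coeff N N k * Bernstein N k x))"
  proof (intro sum.cong refl)
    fix k assume "k \<in> {0..N}"
    then have *: "- shift_op N (dual_coeff N i) k = shift_op N (\<lambda>j. dual_coeff N j k) i
        - dual_coeff N i 0 * dual_coeff N 0 k + dual_coeff N i N * dual_coeff N N k"
      using dual_coeff_recurrence[OF assms, of k] by simp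
    show "- shift_op N (dual_coeff N i) k * Bernstein N k x
      = shift_op N (\<lambda>j. dual_coeff N j k * Bernstein N k x) i
        - dual_coeff N i 0 * (dual_coeff N 0 k * Bernstein N k x)
        + dual_coeff N i N * (dual_coeff N N k * Bernstein N k x)"
      unfolding * shift_op_mult_right by (simp add: algebra_simps)
  qed
  also have "\<dots> = shift_op N (\<lambda>j. dual_bernstein N j x) i - dual_coeff N i 0 * dual_bernstein N 0 x
     + dual_coeff N i N * dual_bernstein N N x"
    unfolding dual_bernstein_def shift_op_sum by (simp add: sum.distrib sum_subtractf sum_distrib_left)
  finally show ?thesis
    using sum_Bernstein_has_real_derivative[where c = "dual_coeff N i" and N = N and x = x] by (simp add: dual_bernstein_def[abs_def])
qed

section \<open>Row sums of \<open>P_mat\<close> and \<open>G_mat\<close>\<close>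

text \<open>The Kronecker deltas in columns 0 and \<open>N\<close> are exactly the tridiagonal
  entries there, so \<open>P_mat\<close> is a tridiagonal matrix plus two columns of dual
  coefficients.\<close>

lemma P_mat_entry:
  assumes "i \<le> N" "j \<le> N" "N \<ge> 1"
  shows "P_mat N $$ (i, j) = real i * of_bool (i = Suc j) + (real N - 2 * real i) * of_bool (j = i)
     - (real N - real i) * of_bool (j = Suc i)
     - dual_coeff N i 0 * of_bool (j = 0) + dual_coeff N i N * of_bool (j = N)"
proof -
  have "P_col0 N i = - dual_coeff N i 0 + real N * of_bool (i = 0) + of_bool (i = 1)"
    using assms by (simp add: P_col0_def dual_coeff_0_right algebra_simps del: binomial_Suc_Suc)
  moreover have "- P_col0 N (N - i) = dual_coeff N i N - real N * of_bool (i = N) - of_bool (Suc i = N)"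
  proof -
    have "(-1::real) ^ (N - i) = (-1) ^ (i + N)" using assms
      by (metis add.commute le_add_diff_inverse minus_one_power_iff even_add)
    moreover have "Suc N choose (Suc (N - i)) = Suc N choose i"
      using assms by (subst binomial_symmetric) (auto simp: Suc_diff_le)
    moreover have "N - i = 0 \<longleftrightarrow> i = N" "N - i = 1 \<longleftrightarrow> Suc i = N" using assms by auto
    ultimately show ?thesis
      using assms by (simp add: P_col0_def dual_coeff_N_right del: binomial_Suc_Suc)
  qed
  ultimately show ?thesis using assms by (auto simp: P_mat_def)
qed

lemma P_mat_row_sum:
  assumes "i \<le> N" "N \<ge> 1"
  shows "(\<Sum>j = 0..<N + 1. P_mat N $$ (i, j) * f j)
    = shift_op N f i - dual_coeff N i 0 * f 0 + dual_coeff N i N * f N"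
proof -
  have "(\<Sum>j = 0..<N + 1. P_mat N $$ (i, j) * f j)
    = (\<Sum>j\<le>N. (if i = Suc j then real i * f j else 0) + (if j = i then (real N - 2 * real i) * f j else 0)
     - (if j = Suc i then (real N - real i) * f j else 0)
     - (if j = 0 then dual_coeff N i 0 * f j else 0) + (if j = N then dual_coeff N i N * f j else 0))"
    using assms by (intro sum.cong) (auto simp: P_mat_entry algebra_simps)
  also have "\<dots> = (\<Sum>j\<le>N. if i = Suc j then real i * f j else 0) + (real N - 2 * real i) * f i
     - (real N - real i) * f (Suc i) - dual_coeff N i 0 * f 0 + dual_coeff N i N * f N"
    using assms by (auto simp: sum.distrib sum_subtractf)
  also have "(\<Sum>j\<le>N. if i = Suc j then real i * f j else 0) = real i * f (i - 1)"
  proof (cases i)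
    case (Suc m)
    then have "(\<Sum>j\<le>N. if i = Suc j then real i * f j else 0) = (\<Sum>j\<le>N. if j = m then real i * f j else 0)"
      by (intro sum.cong) auto
    then show ?thesis using Suc assms by simp
  qed simp
  finally show ?thesis by (simp add: shift_op_def)
qed

text \<open>Used twice: with \<open>f\<close> the derivatives of the dual polynomials, and with
  \<open>f\<close> a column of \<open>P_mat\<close>.\<close>

lemma G_mat_row_sum:
  assumes "i < N - 1"
  shows "(\<Sum>k = 0..<N + 1. G_mat N $$ (i, k) * f k)
    = f i + modal_a N i * f (i + 1) + modal_b N i * f (i + 2)"
proof -
  have "(\<Sum>k = 0..<N + 1. G_mat N $$ (i, k) * f k)
    = (\<Sum>k\<le>N. (if k = i then f k else 0) + (if k = i + 1 then modal_a N i * f k else 0)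
        + (if k = i + 2 then modal_b N i * f k else 0))"
    using assms by (intro sum.cong) (auto simp: G_mat_def)
  moreover have "i \<le> N" "i + 1 \<le> N" "i + 2 \<le> N" using assms by auto
  ultimately show ?thesis by (simp add: sum.distrib)
qed

text \<open>These are the values of \<open>modal N i\<close> at 0 and 1. After the common binomial
  is divided out, each sum is a multiple of the second difference of a linear function, such as
  \<open>(n - x + 1) - 2 * (n - x) + (n - x - 1)\<close>.\<close>

lemma modal_coeff_ends:
  assumes "i < N - 1"
  shows "dual_coeff N i 0 + modal_a N i * dual_coeff N (i + 1) 0 + modal_b N i * dual_coeff N (i + 2) 0 = 0"
    and "dual_coeff N i N + modal_a N i * dual_coeff N (i + 1) N + modal_b N i * dual_coeff N (i + 2) N = 0"
proof -
  have i: "real i + 2 \<le> real N" using assms by linarith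
  have le: "i \<le> N" "i + 1 \<le> N" "i + 2 \<le> N" using assms by auto
  have c0: "real (Suc N choose Suc i) = real (Suc N choose i) * (real N - real i + 1) / (real i + 1)"
    using choose_Suc_right[of "Suc N" i] by (simp add: field_simps del: binomial_Suc_Suc)
  have c1: "real (Suc N choose Suc (Suc i)) = real (Suc N choose Suc i) * (real N - real i) / (real i + 2)"
    using choose_Suc_right[of "Suc N" "Suc i"] by (simp add: field_simps del: binomial_Suc_Suc)
  have c2: "real (Suc N choose Suc (Suc (Suc i))) = real (Suc N choose Suc (Suc i)) * (real N - real i - 1) / (real i + 3)"
    using choose_Suc_right[of "Suc N" "Suc (Suc i)"] by (simp add: field_simps del: binomial_Suc_Suc)
  have nz: "real i + 1 \<noteq> 0" "real i + 2 \<noteq> 0" "real i + 3 \<noteq> 0" "real N - real i \<noteq> 0" "real N - real i + 1 \<noteq> 0" using i by linarith+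
  have e0: "X + (2 * x + 4) / (n - x + 1) * - (X * (n - x) / (x + 2))
     + (x + 2) * (x + 3) / ((n - x) * (n - x + 1)) * (X * (n - x) / (x + 2) * (n - x - 1) / (x + 3)) = 0"
    if "x + 2 \<noteq> 0" "x + 3 \<noteq> 0" "n - x \<noteq> 0" "n - x + 1 \<noteq> 0" for X x n :: real
    using that by (simp add: divide_simps) (simp add: algebra_simps)
  show "dual_coeff N i 0 + modal_a N i * dual_coeff N (i + 1) 0 + modal_b N i * dual_coeff N (i + 2) 0 = 0"
  proof -
    have "dual_coeff N i 0 + modal_a N i * dual_coeff N (i + 1) 0 + modal_b N i * dual_coeff N (i + 2) 0
      = (-1) ^ i * (real N + 1) * (real (Suc N choose Suc i)
         + modal_a N i * - real (Suc N choose Suc (Suc i)) + modal_b N i * real (Suc N choose Suc (Suc (Suc i))))"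
      unfolding le[THEN dual_coeff_0_right] by (simp add: algebra_simps del: binomial_Suc_Suc)
    also have "\<dots> = 0"
      unfolding c2 c1 modal_a_def modal_b_def using e0[OF nz(2-5)] by simp
    finally show ?thesis .
  qed
  have e1: "X + (2 * x + 4) / (n - x + 1) * - (X * (n - x + 1) / (x + 1))
     + (x + 2) * (x + 3) / ((n - x) * (n - x + 1)) * (X * (n - x + 1) / (x + 1) * (n - x) / (x + 2)) = 0"
    if "x + 1 \<noteq> 0" "x + 2 \<noteq> 0" "n - x \<noteq> 0" "n - x + 1 \<noteq> 0" for X x n :: real
    using that by (simp add: divide_simps) (simp add: algebra_simps)
  show "dual_coeff N i N + modal_a N i * dual_coeff N (i + 1) N + modal_b N i * dual_coeff N (i + 2) N = 0"
  proof -
    have "dual_coeff N i N + modal_a N i * dual_coeff N (i + 1) N + modal_b N i * dual_coeff N (i + 2) N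
      = (-1) ^ (i + N) * (real N + 1) * (real (Suc N choose i)
         + modal_a N i * - real (Suc N choose Suc i) + modal_b N i * real (Suc N choose Suc (Suc i)))"
      unfolding le[THEN dual_coeff_N_right] by (simp add: algebra_simps del: binomial_Suc_Suc)
    also have "\<dots> = 0"
      unfolding c1 c0 modal_a_def modal_b_def using e1[OF nz(1,2,4,5)] by simp
    finally show ?thesis .
  qed
qed

section \<open>Derivative formula and band structure\<close>

theorem lemma3:
  fixes N :: nat and Q :: "real mat"
  assumes "N \<ge> 2"
    and "Q = G_mat N * P_mat N"
  shows "has_entrywise_derivative (modal_vec N) (\<lambda>x. Q *\<^sub>v dual_vec N x)
    \<and> Q \<in> carrier_mat (N - 1) (N + 1)
    \<and> band_mat 1 3 Q"
proof (intro conjI)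
  have G: "G_mat N \<in> carrier_mat (N - 1) (N + 1)" and P: "P_mat N \<in> carrier_mat (N + 1) (N + 1)"
    by (simp_all add: G_mat_def P_mat_def)
  then show Q: "Q \<in> carrier_mat (N - 1) (N + 1)" unfolding assms(2) by (rule mult_carrier_mat)
  have N: "N \<ge> 1" using assms(1) by simp
  show "has_entrywise_derivative (modal_vec N) (\<lambda>x. Q *\<^sub>v dual_vec N x)"
    unfolding has_entrywise_derivative_def
  proof (intro conjI allI impI)
    show "dim_vec (modal_vec N x) = dim_vec (Q *\<^sub>v dual_vec N x)" for x
      using Q by (simp add: modal_vec_def)
  next
    fix x i assume "i < dim_vec (Q *\<^sub>v dual_vec N x)"
    then have i: "i < N - 1" using Q by simp
    then have le: "i \<le> N" "i + 1 \<le> N" "i + 2 \<le> N" by auto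
    define D where "D k = shift_op N (\<lambda>j. dual_bernstein N j x) k - dual_coeff N k 0 * dual_bernstein N 0 x
     + dual_coeff N k N * dual_bernstein N N x" for k
    have v: "dual_vec N x \<in> carrier_vec (N + 1)" by (simp add: dual_vec_def)
    have "(P_mat N *\<^sub>v dual_vec N x) $ k = D k" if "k \<le> N" for k
    proof -
      have "(P_mat N *\<^sub>v dual_vec N x) $ k = (\<Sum>j = 0..<N + 1. P_mat N $$ (k, j) * dual_bernstein N j x)"
        using that P v by (auto simp: scalar_prod_def dual_vec_def intro!: sum.cong)
      then show ?thesis using P_mat_row_sum[OF that N] by (simp add: D_def)
    qed
    then have "(Q *\<^sub>v dual_vec N x) $ i = (\<Sum>k = 0..<N + 1. G_mat N $$ (i, k) * D k)"
      unfolding assms(2) assoc_mult_mat_vec[OF G P v] using G P v i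
      by (auto simp: scalar_prod_def intro!: sum.cong)
    then have Qi: "(Q *\<^sub>v dual_vec N x) $ i = D i + modal_a N i * D (i + 1) + modal_b N i * D (i + 2)"
      using G_mat_row_sum[OF i] by simp
    have "(modal N i has_real_derivative D i + modal_a N i * D (i + 1) + modal_b N i * D (i + 2)) (at x)"
      unfolding modal_def[abs_def] D_def
      by (intro DERIV_add DERIV_cmult dual_bernstein_has_real_derivative le)
    then show "((\<lambda>y. modal_vec N y $ i) has_real_derivative (Q *\<^sub>v dual_vec N x) $ i) (at x)"
      unfolding Qi using i by (simp add: modal_vec_def)
  qed
  show "band_mat 1 3 Q"
    unfolding band_mat_def
  proof (intro allI impI)
    fix i j assume "i < dim_row Q" "j < dim_col Q" and nz: "Q $$ (i, j) \<noteq> 0"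
    then have i: "i < N - 1" and j: "j \<le> N" using Q by auto
    then have le: "i \<le> N" "i + 1 \<le> N" "i + 2 \<le> N" by auto
    have "Q $$ (i, j) = (\<Sum>k = 0..<N + 1. G_mat N $$ (i, k) * P_mat N $$ (k, j))"
      unfolding assms(2) using G P i j by (auto simp: scalar_prod_def intro!: sum.cong)
    also have "\<dots> = P_mat N $$ (i, j) + modal_a N i * P_mat N $$ (i + 1, j) + modal_b N i * P_mat N $$ (i + 2, j)"
      by (rule G_mat_row_sum[OF i])
    finally have Qij: "Q $$ (i, j) = P_mat N $$ (i, j) + modal_a N i * P_mat N $$ (i + 1, j) + modal_b N i * P_mat N $$ (i + 2, j)" .
    show "i \<le> j + 1 \<and> j \<le> i + 3"
    proof (rule ccontr)
      assume "\<not> (i \<le> j + 1 \<and> j \<le> i + 3)"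
      \<comment> \<open>The tridiagonal parts of rows \<open>i\<close> to \<open>i + 2\<close>
        together reach only columns \<open>i - 1\<close> to \<open>i + 3\<close>. Outside, only the
        full columns 0 and \<open>N\<close> contribute, and \<open>modal_coeff_ends\<close> cancels
        them.\<close>
      then have out: "k = Suc j \<longleftrightarrow> False" "j = k \<longleftrightarrow> False" "j = Suc k \<longleftrightarrow> False" if "k \<in> {i, i + 1, i + 2}" for k
        using that by auto
      have p: "P_mat N $$ (k, j) = - dual_coeff N k 0 * of_bool (j = 0) + dual_coeff N k N * of_bool (j = N)"
        if "k \<in> {i, i + 1, i + 2}" for k
      proof -
        have "k \<le> N" using that le by auto
        then show ?thesis unfolding P_mat_entry[OF \<open>k \<le> N\<close> j N] out[OF that] by simp
      qed
      have "Q $$ (i, j) =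
          - (dual_coeff N i 0 + modal_a N i * dual_coeff N (i + 1) 0 + modal_b N i * dual_coeff N (i + 2) 0) * of_bool (j = 0)
          + (dual_coeff N i N + modal_a N i * dual_coeff N (i + 1) N + modal_b N i * dual_coeff N (i + 2) N) * of_bool (j = N)"
        unfolding Qij p[OF insertI1] p[OF insertI2, OF insertI1] p[OF insertI2, OF insertI2, OF insertI1]
        by (simp add: algebra_simps)
      then have "Q $$ (i, j) = 0"
        unfolding modal_coeff_ends[OF i] by simp
      with nz show False by simp
    qed
  qed
qed

end
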